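(* Let $d\ge 1$ and let $\mu$ be a probability measure on $\mathbb{R}^d$ that has a density $f$ with respect to Lebesgue measure. Let $X_1,X_2,\ldots$ be i.i.d. random vectors with distribution $\mu$, and for each $n$ let $S_1$ be the Voronoi cell of $X_1$ in the Voronoi partition defined by $X_1,\ldots,X_n$. Then for $\mu$-almost all $x\in\mathbb{R}^d$, $$\lim_{t\to\infty}\limsup_{n\to\infty}\mathbb{P}\left\{n^{1/d}\,\mathrm{diam}(S_1)\ge t\mid X_1=x\right\}=0.$$
   Context: $\|\cdot\|$ is the Euclidean norm on $\mathbb{R}^d$, and $\mathrm{diam}(S)=\sup_{y,z\in S}\|y-z\|\in[0,\infty]$ is the diameter of a set $S\subset\mathbb{R}^d$. Voronoi partition: given $X_1,\ldots,X_n$, the cell $S_i$ consists of all points of $\mathbb{R}^d$ whose nearest neighbor among $X_1,\ldots,X_n$ is $X_i$, ties being broken in favor of smaller indices. In particular $S_1=\{y\in\mathbb{R}^d:\|y-X_1\|\le\|y-X_j\| \text{ for all } j=2,\ldots,n\}$; it depends on $n$. Conditioning on $X_1=x$ means that $X_1$ is replaced by the fixed point $x$ while $X_2,\ldots,X_n$ remain i.i.d. with distribution $\mu$. *)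

theory Defs
  imports "HOL-Probability.Probability"
begin

text \<open>Points are indexed from 1: the sites are \<open>p 1, \<dots>, p n\<close>.
  The strict inequality against smaller indices implements the tie-breaking rule.\<close>

definition voronoi_cell :: "(nat \<Rightarrow> 'a::real_normed_vector) \<Rightarrow> nat \<Rightarrow> nat \<Rightarrow> 'a set" where
  "voronoi_cell p n i =
     {y. (\<forall>j\<in>{1..n}. norm (y - p i) \<le> norm (y - p j)) \<and>
         (\<forall>j\<in>{1..<i}. norm (y - p i) < norm (y - p j))}"

text \<open>The library's \<open>diameter\<close> is real-valued and carries no information on unbounded
  sets, but Voronoi cells may be unbounded and then have diameter \<open>\<infinity>\<close>.\<close>

definition ediam :: "'a::real_normed_vector set \<Rightarrow> ennreal" where
  "ediam S = (SUP y\<in>S. SUP z\<in>S. ennreal (norm (y - z)))"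

text \<open>The probability of \<open>n\<^sup>1\<^sup>/\<^sup>d diam S\<^sub>1 \<ge> t\<close> conditionally on \<open>X\<^sub>1 = x\<close>: the first site is
  replaced by the fixed point \<open>x\<close>, the others stay random.\<close>

definition cond_prob_cell ::
  "'b measure \<Rightarrow> (nat \<Rightarrow> 'b \<Rightarrow> 'a::euclidean_space) \<Rightarrow> nat \<Rightarrow> real \<Rightarrow> 'a \<Rightarrow> real" where
  "cond_prob_cell M X n t x =
     measure M {\<omega> \<in> space M.
       ennreal (real n powr (1 / real DIM('a))) *
         ediam (voronoi_cell ((\<lambda>j. X j \<omega>)(1 := x)) n 1) \<ge> ennreal t}"

end

theory Submission
  imports Defs "HOL-Real_Asymp.Real_Asymp"
begin

text \<open>Fix a finite \<open>1/4\<close>-net \<open>D\<close> of the unit sphere. If each ball \<open>B(x + r u, r/4)\<close> with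
  \<open>u \<in> D\<close> contains a site, then the cell of \<open>x\<close> lies in \<open>B(x, r)\<close>: a point of the cell at distance
  at least \<open>r\<close> would be closer to the site found in its own direction. At almost every \<open>x\<close> these
  balls have mass at least \<open>c\<^sub>u r\<^sup>d\<close> for small \<open>r\<close>, because \<open>x\<close> is a density point of some
  \<open>{f \<ge> 1/k}\<close>. With \<open>r = t / (3 n\<^sup>1\<^sup>/\<^sup>d)\<close> the probability that one of the balls is missed by all of
  \<open>X\<^sub>2, \<dots>, X\<^sub>n\<close> is at most the sum over \<open>u\<close> of \<open>exp (- c\<^sub>u (t/3)\<^sup>d / 2)\<close>.\<close>

section \<open>Null sets from a density bound at small scales\<close>

text \<open>By Vitali covering, disjoint small balls inside a nearly optimal open cover exhaust
  \<open>S\<close> up to a null set, and inside each of them \<open>S\<close> fits into a fraction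
  \<open>q\<close> of the volume. So a cover of finite measure can be replaced by one that is
  smaller by nearly the factor \<open>q\<close>.\<close>

lemma negligible_bounded_density_le:
  fixes S :: "'a::euclidean_space set"
  assumes q: "0 \<le> q" "q < 1" and bS: "bounded S"
    and dens: "\<And>x \<rho>. \<lbrakk>x \<in> S; 0 < \<rho>\<rbrakk> \<Longrightarrow> \<exists>r. 0 < r \<and> r < \<rho> \<and>
      (\<exists>U\<in>sets lebesgue. S \<inter> ball x r \<subseteq> U \<and>
        emeasure lebesgue U \<le> ennreal q * emeasure lebesgue (ball x r))"
  shows "negligible S"
proof -
  \<comment> \<open>Hence the outer measure \<open>m\<close> of \<open>S\<close> satisfies \<open>m \<le> q m\<close>; working with outer measure avoids
    assuming that \<open>S\<close> is measurable.\<close>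
  have shrink: "\<exists>W\<in>lmeasurable. S \<subseteq> W \<and> measure lebesgue W \<le> q * (measure lebesgue T + e)"
    if T: "T \<in> lmeasurable" "S \<subseteq> T" and e: "0 < e" for T and e :: real
  proof -
    \<comment> \<open>Openness leaves room around each point of \<open>S\<close> for small balls
      inside \<open>V\<close>, at the price of an extra measure \<open>e\<close>.\<close>
    obtain V where V: "open V" "T \<subseteq> V" "V - T \<in> lmeasurable" "emeasure lebesgue (V - T) < ennreal e"
      using sets_lebesgue_outer_open[of T e] T e by blast
    have VT: "V = T \<union> (V - T)" using V by auto
    have Vm: "V \<in> lmeasurable" using VT T V by (metis fmeasurable.Un)
    have "measure lebesgue (V - T) \<le> e"
      using V(3,4) e by (simp add: emeasure_eq_measure2 ennreal_less_iff)
    moreover have "measure lebesgue V \<le> measure lebesgue T + measure lebesgue (V - T)"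
      by (subst VT, rule measure_Un_le) (use T V in auto)
    ultimately have mV: "measure lebesgue V \<le> measure lebesgue T + e" by linarith
    \<comment> \<open>An index \<open>i\<close> is a pair of centre and radius. The balls of
      \<open>K\<close> lie in \<open>V\<close> and form a fine cover of \<open>S\<close>, as the
      Vitali theorem requires.\<close>
    define good where "good = (\<lambda>i U. U \<in> sets lebesgue \<and> S \<inter> ball (fst i) (snd i) \<subseteq> U \<and>
        emeasure lebesgue U \<le> ennreal q * emeasure lebesgue (ball (fst i :: 'a) (snd i)))"
    define K where "K = {i. 0 < snd i \<and> ball (fst i) (snd i) \<subseteq> V \<and> (\<exists>U. good i U)}"
    have cover: "\<exists>i. i \<in> K \<and> x \<in> ball (fst i) (snd i) \<and> snd i < \<rho>" if x: "x \<in> S" "0 < \<rho>" for x \<rho>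
    proof -
      obtain \<epsilon> where \<epsilon>: "0 < \<epsilon>" "ball x \<epsilon> \<subseteq> V"
        using V T x by (meson open_contains_ball subsetD)
      obtain r where r: "0 < r" "r < min \<rho> \<epsilon>" and U: "\<exists>U\<in>sets lebesgue. S \<inter> ball x r \<subseteq> U \<and>
        emeasure lebesgue U \<le> ennreal q * emeasure lebesgue (ball x r)"
        using dens[of x "min \<rho> \<epsilon>"] x \<epsilon> by auto
      have "ball x r \<subseteq> V" using r \<epsilon> by (meson min_less_iff_conj order_less_imp_le subset_ball subset_trans)
      then have "(x, r) \<in> K" using r U by (auto simp: K_def good_def)
      then show ?thesis using r by (intro exI[of _ "(x, r)"]) auto
    qed
    obtain C where C: "countable C" "C \<subseteq> K"
      "pairwise (\<lambda>i j. disjnt (ball (fst i) (snd i)) (ball (fst j) (snd j))) C"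
      and neg: "negligible (S - (\<Union>i \<in> C. ball (fst i) (snd i)))"
      using Vitali_covering_theorem_balls[of S K fst snd, OF cover] by blast
    have "\<forall>i\<in>K. \<exists>U. good i U" by (simp add: K_def)
    then obtain U where U: "\<And>i. i \<in> K \<Longrightarrow> good i (U i)" by metis
    \<comment> \<open>\<open>U i\<close> may reach outside its ball; cutting it down makes the
      pieces disjoint, so that their measures add up and are compared with that of
      \<open>V\<close>.\<close>
    define W where "W = (\<Union>i\<in>C. U i \<inter> ball (fst i) (snd i))"
    define N where "N = S - (\<Union>i \<in> C. ball (fst i) (snd i))"
    have disj: "disjoint_family_on (\<lambda>i. ball (fst i) (snd i)) C"
      using C(3) by (auto simp: disjoint_family_on_def pairwise_def disjnt_def)
    then have disjU: "disjoint_family_on (\<lambda>i. U i \<inter> ball (fst i) (snd i)) C"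
      by (fastforce simp: disjoint_family_on_def)
    have Us: "U i \<in> sets lebesgue" if "i \<in> C" for i
      using U[of i] C(2) that by (auto simp: good_def)
    have "emeasure lebesgue W = (\<integral>\<^sup>+ i. emeasure lebesgue (U i \<inter> ball (fst i) (snd i)) \<partial>count_space C)"
      unfolding W_def by (rule emeasure_UN_countable) (use C disjU Us in auto)
    also have "\<dots> \<le> (\<integral>\<^sup>+ i. ennreal q * emeasure lebesgue (ball (fst i) (snd i)) \<partial>count_space C)"
    proof (rule nn_integral_mono, clarsimp simp del: ball_eq_empty)
      fix a b assume i: "(a, b) \<in> C"
      have "emeasure lebesgue (U (a, b) \<inter> ball a b) \<le> emeasure lebesgue (U (a, b))"
        by (rule emeasure_mono) (use Us[OF i] in auto)
      also have "\<dots> \<le> ennreal q * emeasure lebesgue (ball a b)"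
        using U[of "(a,b)"] i C(2) by (auto simp: good_def)
      finally show "emeasure lebesgue (U (a, b) \<inter> ball a b) \<le> ennreal q * emeasure lborel (ball a b)"
        by simp
    qed
    also have "\<dots> = ennreal q * (\<integral>\<^sup>+ i. emeasure lebesgue (ball (fst i) (snd i)) \<partial>count_space C)"
      by (rule nn_integral_cmult) simp
    also have "(\<integral>\<^sup>+ i. emeasure lebesgue (ball (fst i) (snd i)) \<partial>count_space C) =
        emeasure lebesgue (\<Union>i\<in>C. ball (fst i) (snd i))"
      by (rule emeasure_UN_countable[symmetric]) (use C disj in auto)
    also have "\<dots> \<le> emeasure lebesgue V"
      by (rule emeasure_mono) (use C(2) Vm in \<open>auto simp: K_def\<close>)
    finally have eW: "emeasure lebesgue W \<le> ennreal (q * measure lebesgue V)"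
      using Vm q by (simp add: mult_left_mono emeasure_eq_measure2 ennreal_mult)
    have Ws: "W \<in> sets lebesgue"
      unfolding W_def by (rule sets.countable_UN'') (use C Us in auto)
    have Wm: "W \<in> lmeasurable"
      using Ws eW by (auto simp: fmeasurable_def intro: le_less_trans)
    have Nm: "N \<in> lmeasurable" "measure lebesgue N = 0"
      using neg unfolding N_def negligible_iff_measure by auto
    have mW: "measure lebesgue W \<le> q * measure lebesgue V"
      using eW Wm q by (simp add: emeasure_eq_measure2)
    have "measure lebesgue (W \<union> N) \<le> measure lebesgue W + measure lebesgue N"
      by (rule measure_Un_le) (use Wm Nm in auto)
    also have "\<dots> \<le> q * (measure lebesgue T + e)"
      using mW Nm mV mult_left_mono[OF mV q(1)] by linarith
    finally have "measure lebesgue (W \<union> N) \<le> q * (measure lebesgue T + e)" .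
    moreover have "S \<subseteq> W \<union> N"
    proof
      fix x assume x: "x \<in> S"
      show "x \<in> W \<union> N"
      proof (cases "x \<in> N")
        case False
        then obtain i where i: "i \<in> C" "x \<in> ball (fst i) (snd i)" using x by (auto simp: N_def)
        then have "i \<in> K" using C(2) by blast
        then have "x \<in> U i" using U[of i] i x by (auto simp: good_def)
        then show ?thesis using i by (auto simp: W_def)
      qed simp
    qed
    ultimately show ?thesis using Wm Nm by (intro bexI[of _ "W \<union> N"]) auto
  qed
  define Q where "Q = {T \<in> lmeasurable. S \<subseteq> T}"
  define m where "m = (INF T\<in>Q. measure lebesgue T)"
  have bdd: "bdd_below (measure lebesgue ` Q)" by (rule bdd_belowI[of _ 0]) auto
  \<comment> \<open>Boundedness enters here: a ball containing \<open>S\<close> belongs to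
    \<open>Q\<close>, so the infimum \<open>m\<close> is taken over a nonempty set and is the outer
    measure of \<open>S\<close>.\<close>
  obtain b where "S \<subseteq> ball 0 b" using bS bounded_subset_ballD by blast
  then have Q: "Q \<noteq> {}" by (auto simp: Q_def intro!: exI[of _ "ball 0 b"])
  have m0: "0 \<le> m" unfolding m_def by (rule cINF_greatest) (use Q in auto)
  have "m = 0"
  proof (rule ccontr)
    assume "m \<noteq> 0"
    then have mp: "0 < m" using m0 by simp
    \<comment> \<open>With this \<open>e\<close> the new cover has measure at most
      \<open>q * (m + 2 * e) = m * (1 - (1 - q)^2)\<close>, which is below the infimum
      \<open>m\<close>.\<close>
    define e where "e = m * (1 - q) / 2"
    have e: "0 < e" using mp q by (simp add: e_def)
    have "(INF T\<in>Q. measure lebesgue T) < m + e" using e by (simp add: m_def)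
    then obtain T where T: "T \<in> Q" "measure lebesgue T < m + e"
      using Q bdd by (auto simp: cINF_less_iff)
    obtain W where W: "W \<in> Q" "measure lebesgue W \<le> q * (measure lebesgue T + e)"
      using shrink[of T e] T e by (auto simp: Q_def)
    have "m \<le> measure lebesgue W" unfolding m_def by (rule cINF_lower[OF bdd W(1)])
    also note W(2)
    also have "q * (measure lebesgue T + e) \<le> q * (m + 2 * e)"
      using T(2) q(1) by (intro mult_left_mono) auto
    finally have "m \<le> q * (m + m * (1 - q))" by (simp add: e_def)
    then have "m * (1 - q) * (1 - q) \<le> 0" by (simp add: algebra_simps)
    moreover have "0 < m * (1 - q) * (1 - q)" using mp q by simp
    ultimately show False by linarith
  qed
  show ?thesis unfolding negligible_outer
  proof (intro allI impI)
    fix e :: real assume "0 < e"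
    then have "(INF T\<in>Q. measure lebesgue T) < e" using \<open>m = 0\<close> by (simp add: m_def)
    then obtain T where "T \<in> Q" "measure lebesgue T < e"
      using Q bdd by (auto simp: cINF_less_iff)
    then show "\<exists>T. S \<subseteq> T \<and> T \<in> lmeasurable \<and> measure lebesgue T < e" by (auto simp: Q_def)
  qed
qed

text \<open>The hypothesis passes to subsets of \<open>S\<close> with the same \<open>U\<close>, so
  the bounded case applies to each \<open>S \<inter> ball 0 n\<close>.\<close>

lemma negligible_density_le:
  fixes S :: "'a::euclidean_space set"
  assumes q: "0 \<le> q" "q < 1"
    and dens: "\<And>x \<rho>. \<lbrakk>x \<in> S; 0 < \<rho>\<rbrakk> \<Longrightarrow> \<exists>r. 0 < r \<and> r < \<rho> \<and>
      (\<exists>U\<in>sets lebesgue. S \<inter> ball x r \<subseteq> U \<and>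
        emeasure lebesgue U \<le> ennreal q * emeasure lebesgue (ball x r))"
  shows "negligible S"
proof -
  have "negligible (S \<inter> ball 0 (real n))" for n
  proof (rule negligible_bounded_density_le[OF q])
    fix x and \<rho> :: real assume "x \<in> S \<inter> ball 0 (real n)" "0 < \<rho>"
    then show "\<exists>r. 0 < r \<and> r < \<rho> \<and>
      (\<exists>U\<in>sets lebesgue. S \<inter> ball 0 (real n) \<inter> ball x r \<subseteq> U \<and>
        emeasure lebesgue U \<le> ennreal q * emeasure lebesgue (ball x r))"
      using dens[of x \<rho>] by (meson IntD1 Int_lower1 Int_mono order_refl subset_trans)
  qed (simp add: bounded_Int)
  then have "negligible (\<Union>n. S \<inter> ball 0 (real n))" by (rule negligible_Union_nat)
  moreover have "(\<Union>n. S \<inter> ball 0 (real n)) = S"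
    by (auto simp: reals_Archimedean2)
  ultimately show ?thesis by simp
qed

section \<open>Mass of off-centre balls\<close>

text \<open>Each failure of the bound leaves a fixed fraction of a ball centred at \<open>x\<close>
  free of \<open>A\<close>. The points of \<open>A\<close> where this happens at arbitrarily small
  scales form a null set by the density criterion.\<close>

lemma AE_half_density_off_centre_ball:
  fixes A :: "'a::euclidean_space set"
  assumes A: "A \<in> sets lebesgue" and u: "norm u \<le> 1"
  shows "AE x in lebesgue. x \<in> A \<longrightarrow> (\<forall>\<^sub>F r in at_right 0.
    measure lebesgue (ball (x + r *\<^sub>R u) (r / 4)) / 2 \<le> measure lebesgue (A \<inter> ball (x + r *\<^sub>R u) (r / 4)))"
proof -
  define P where "P = (\<lambda>x r. measure lebesgue (ball (x + r *\<^sub>R u) (r / 4)) / 2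
    \<le> measure lebesgue (A \<inter> ball (x + r *\<^sub>R u) (r / 4)))"
  define N where "N = {x \<in> A. \<not> (\<forall>\<^sub>F r in at_right 0. P x r)}"
  \<comment> \<open>The radii \<open>r / 4\<close> and \<open>2 * r\<close> have ratio
    \<open>1 / 8\<close>. If \<open>A\<close> fills less than half of the small ball, it misses more
    than the fraction \<open>(1 / 8) ^ d / 2\<close> of the large one.\<close>
  define q :: real where "q = 1 - (1 / 8) ^ DIM('a) / 2"
  have "(1 / 8 :: real) ^ DIM('a) \<le> 1" by (rule power_le_one) auto
  then have q: "0 \<le> q" "q < 1" by (auto simp: q_def)
  have "negligible N"
  proof (rule negligible_density_le[OF q])
    fix x and \<rho> :: real assume x: "x \<in> N" and \<rho>: "0 < \<rho>"
    have "\<not> (\<exists>b>0. \<forall>r>0. r < b \<longrightarrow> P x r)"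
      using x by (simp add: N_def eventually_at_right_field)
    \<comment> \<open>Half of \<rho>, because the density criterion is applied with radius
      \<open>2 * r\<close>.\<close>
    then obtain r where r: "0 < r" "r < \<rho> / 2" "\<not> P x r"
      using half_gt_zero[OF \<rho>] by blast
    define B where "B = ball x (2 * r)"
    define b where "b = ball (x + r *\<^sub>R u) (r / 4)"
    have "b \<subseteq> B"
    proof
      fix y assume "y \<in> b"
      then have "dist (x + r *\<^sub>R u) y < r / 4" by (simp add: b_def)
      moreover have "dist x (x + r *\<^sub>R u) \<le> r" using u r by (simp add: dist_norm)
      ultimately have "dist x y < 2 * r" using dist_triangle[of x y "x + r *\<^sub>R u"] r by linarith
      then show "y \<in> B" by (simp add: B_def)
    qed
    have bm: "b \<in> lmeasurable" and Bm: "B \<in> lmeasurable" by (auto simp: b_def B_def)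
    have Am: "A \<inter> B \<in> lmeasurable" "A \<inter> b \<in> lmeasurable"
      using fmeasurable_Int_fmeasurable[OF Bm A] fmeasurable_Int_fmeasurable[OF bm A]
      by (auto simp: Int_commute)
    have bB: "measure lebesgue b = (1 / 8) ^ DIM('a) * measure lebesgue B"
    proof -
      have "measure lebesgue b = (1 / 8 * (2 * r)) ^ DIM('a) * measure lebesgue (ball (0::'a) 1)"
        using r content_ball_conv_unit_ball[of "r / 4" "x + r *\<^sub>R u"] by (simp add: b_def)
      also have "\<dots> = (1 / 8) ^ DIM('a) * ((2 * r) ^ DIM('a) * measure lebesgue (ball (0::'a) 1))"
        by (simp only: power_mult_distrib mult.assoc)
      also have "(2 * r) ^ DIM('a) * measure lebesgue (ball (0::'a) 1) = measure lebesgue B"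
        using r content_ball_conv_unit_ball[of "2 * r" x] by (simp add: B_def)
      finally show ?thesis .
    qed
    have "measure lebesgue (A \<inter> B) \<le> measure lebesgue ((A \<inter> b) \<union> (B - b))"
      by (rule measure_mono_fmeasurable) (use Am bm Bm A in auto)
    also have "\<dots> \<le> measure lebesgue (A \<inter> b) + measure lebesgue (B - b)"
      by (rule measure_Un_le) (use Am bm Bm A in auto)
    also have "measure lebesgue (B - b) = measure lebesgue B - measure lebesgue b"
      by (rule measurable_measure_Diff) (use bm Bm \<open>b \<subseteq> B\<close> in auto)
    also have "measure lebesgue (A \<inter> b) < measure lebesgue b / 2"
      using r(3) by (simp add: P_def b_def)
    finally have "measure lebesgue (A \<inter> B) \<le> q * measure lebesgue B"
      using bB by (simp add: q_def algebra_simps)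
    then have "emeasure lebesgue (A \<inter> B) \<le> ennreal q * emeasure lebesgue B"
      using Am Bm q by (simp add: emeasure_eq_measure2 flip: ennreal_mult)
    \<comment> \<open>Measurability of \<open>N\<close> has not been shown, so the measurable set
      \<open>A \<inter> B\<close> plays the part of \<open>U\<close>.\<close>
    moreover have "N \<inter> B \<subseteq> A \<inter> B" by (auto simp: N_def)
    ultimately show "\<exists>r. 0 < r \<and> r < \<rho> \<and> (\<exists>U\<in>sets lebesgue. N \<inter> ball x r \<subseteq> U \<and>
        emeasure lebesgue U \<le> ennreal q * emeasure lebesgue (ball x r))"
      using r Am(1) fmeasurableD unfolding B_def
      by (intro exI[of _ "2 * r"] conjI bexI[of _ "A \<inter> ball x (2 * r)"]) auto
  qed
  then have "N \<in> null_sets lebesgue" by (simp add: negligible_iff_null_sets)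
  then have "AE x in lebesgue. x \<notin> N" by (rule AE_not_in)
  then show ?thesis by eventually_elim (auto simp: N_def P_def)
qed

text \<open>Where \<open>f\<close> is positive, \<open>x\<close> lies in some level set
  \<open>{f >= 1 / (k + 1)}\<close>. For small \<open>r\<close> this set fills half of the
  off-centre ball, and on it the density of \<mu> is bounded below. The constant \<open>c\<close>
  depends on \<open>x\<close> and \<open>u\<close>.\<close>

lemma AE_density_off_centre_ball_lower_bound:
  fixes \<mu> :: "'a::euclidean_space measure"
  assumes "prob_space \<mu>"
    and f: "f \<in> borel_measurable borel" "\<And>x. 0 \<le> f x"
    and \<mu>: "\<mu> = density lborel (\<lambda>x. ennreal (f x))"
    and u: "norm u \<le> 1"
  shows "AE x in \<mu>. \<exists>c>0. \<forall>\<^sub>F r in at_right 0.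
    c * r ^ DIM('a) \<le> measure \<mu> (ball (x + r *\<^sub>R u) (r / 4))"
proof -
  interpret \<mu>: prob_space \<mu> by fact
  define A where "A = (\<lambda>k. {x. 1 / real (Suc k) \<le> f x})"
  have Ab: "A k \<in> sets borel" for k
    unfolding A_def using f(1) by measurable
  \<comment> \<open>The level \<open>k\<close> depends on \<open>x\<close>, so the null sets of all
    the countably many levels are discarded first.\<close>
  have "AE x in lborel. \<forall>k. x \<in> A k \<longrightarrow> (\<forall>\<^sub>F r in at_right 0.
    measure lebesgue (ball (x + r *\<^sub>R u) (r / 4)) / 2 \<le> measure lebesgue (A k \<inter> ball (x + r *\<^sub>R u) (r / 4)))"
    unfolding AE_all_countable
    by (intro allI AE_half_density_off_centre_ball[OF _ u, unfolded AE_completion_iff]) (use Ab in simp)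
  \<comment> \<open>For a density, almost everywhere under \<mu> means almost everywhere under
    \<open>lborel\<close> on the set where the density is positive.\<close>
  then have "AE x in lborel. 0 < ennreal (f x) \<longrightarrow> (\<exists>c>0. \<forall>\<^sub>F r in at_right 0.
    c * r ^ DIM('a) \<le> measure \<mu> (ball (x + r *\<^sub>R u) (r / 4)))"
  proof eventually_elim
    fix x assume H: "\<forall>k. x \<in> A k \<longrightarrow> (\<forall>\<^sub>F r in at_right 0.
      measure lebesgue (ball (x + r *\<^sub>R u) (r / 4)) / 2 \<le> measure lebesgue (A k \<inter> ball (x + r *\<^sub>R u) (r / 4)))"
    show "0 < ennreal (f x) \<longrightarrow> (\<exists>c>0. \<forall>\<^sub>F r in at_right 0.
      c * r ^ DIM('a) \<le> measure \<mu> (ball (x + r *\<^sub>R u) (r / 4)))"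
    proof
      assume "0 < ennreal (f x)"
      then obtain k where "1 / real (Suc k) < f x"
        using reals_Archimedean[of "f x"] by (auto simp: inverse_eq_divide)
      then have ev: "\<forall>\<^sub>F r in at_right 0. measure lebesgue (ball (x + r *\<^sub>R u) (r / 4)) / 2
          \<le> measure lebesgue (A k \<inter> ball (x + r *\<^sub>R u) (r / 4))"
        using H by (auto simp: A_def)
      \<comment> \<open>The ball has volume \<open>(r / 4) ^ d\<close> times that of the unit ball;
        half of it lies in \<open>A k\<close>, where \<open>f\<close> is at least
        \<open>1 / Suc k\<close>.\<close>
      define c where "c = (1 / 4) ^ DIM('a) * measure lebesgue (ball (0::'a) 1) / (2 * real (Suc k))"
      have "0 < c" by (auto simp: c_def content_ball_pos)
      moreover have "\<forall>\<^sub>F r in at_right 0. c * r ^ DIM('a) \<le> measure \<mu> (ball (x + r *\<^sub>R u) (r / 4))"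
        using ev eventually_at_right_less[of 0]
      proof eventually_elim
        fix r :: real
        define b where "b = ball (x + r *\<^sub>R u) (r / 4)"
        assume h: "measure lebesgue (ball (x + r *\<^sub>R u) (r / 4)) / 2
          \<le> measure lebesgue (A k \<inter> ball (x + r *\<^sub>R u) (r / 4))" and r: "0 < r"
        have fin: "A k \<inter> b \<in> lmeasurable"
          unfolding b_def using fmeasurable_Int_fmeasurable[of "ball (x + r *\<^sub>R u) (r / 4)" lebesgue "A k"] Ab
          by (auto simp: Int_commute)
        have "measure lebesgue b = (1 / 4) ^ DIM('a) * r ^ DIM('a) * measure lebesgue (ball (0::'a) 1)"
          using content_ball_conv_unit_ball[of "r / 4" "x + r *\<^sub>R u"] r
          by (simp add: b_def power_divide)
        then have "c * r ^ DIM('a) = 1 / real (Suc k) * (measure lebesgue b / 2)"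
          by (simp add: c_def ac_simps)
        also have "\<dots> \<le> 1 / real (Suc k) * measure lebesgue (A k \<inter> b)"
          using h unfolding b_def by (intro mult_left_mono) auto
        finally have 1: "c * r ^ DIM('a) \<le> 1 / real (Suc k) * measure lebesgue (A k \<inter> b)" .
        have Abb: "A k \<inter> b \<in> sets borel" using Ab by (auto simp: b_def)
        have "ennreal (1 / real (Suc k) * measure lebesgue (A k \<inter> b)) =
            ennreal (1 / real (Suc k)) * ennreal (measure lebesgue (A k \<inter> b))"
          by (rule ennreal_mult) auto
        also have "ennreal (measure lebesgue (A k \<inter> b)) = emeasure lebesgue (A k \<inter> b)"
          by (rule emeasure_eq_measure2[OF fin, symmetric])
        also have "\<dots> = emeasure lborel (A k \<inter> b)"
          using Abb by simp
        also have "ennreal (1 / real (Suc k)) * emeasure lborel (A k \<inter> b) =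
            (\<integral>\<^sup>+ y. ennreal (1 / real (Suc k)) * indicator (A k \<inter> b) y \<partial>lborel)"
          by (rule nn_integral_cmult_indicator[symmetric]) (use Abb in simp)
        also have "\<dots> \<le> (\<integral>\<^sup>+ y. ennreal (f y) * indicator b y \<partial>lborel)"
          by (rule nn_integral_mono) (auto simp: A_def indicator_def intro!: ennreal_leI)
        also have "\<dots> = emeasure \<mu> b"
          unfolding \<mu> by (rule emeasure_density[symmetric]) (use f in \<open>auto simp: b_def\<close>)
        also have "\<dots> = ennreal (measure \<mu> b)" by (rule \<mu>.emeasure_eq_measure)
        finally have "1 / real (Suc k) * measure lebesgue (A k \<inter> b) \<le> measure \<mu> b"
          by (simp add: ennreal_le_iff)
        then show "c * r ^ DIM('a) \<le> measure \<mu> (ball (x + r *\<^sub>R u) (r / 4))"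
          using 1 by (simp add: b_def)
      qed
      ultimately show "\<exists>c>0. \<forall>\<^sub>F r in at_right 0.
        c * r ^ DIM('a) \<le> measure \<mu> (ball (x + r *\<^sub>R u) (r / 4))" by blast
    qed
  qed
  then show ?thesis unfolding \<mu> by (subst AE_density) (use f in auto)
qed

section \<open>Geometry of the cell\<close>

text \<open>For \<open>y = p i + w\<close> with \<open>norm w >= r\<close> and direction
  \<open>v\<close>, go from \<open>y\<close> to \<open>p i + r v\<close>, then to
  \<open>p i + r u\<close> with \<open>u\<close> in the net near \<open>v\<close>, then to a site.
  The three lengths are \<open>norm w - r\<close> and twice less than \<open>r / 4\<close>, in total
  less than \<open>norm w\<close>.\<close>

lemma voronoi_cell_subset_ball:
  assumes D: "sphere 0 1 \<subseteq> (\<Union>u\<in>D. ball u (1 / 4))" and r: "0 < r"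
    and hit: "\<And>u. u \<in> D \<Longrightarrow> \<exists>j\<in>{1..n}. p j \<in> ball (p i + r *\<^sub>R u) (r / 4)"
  shows "voronoi_cell p n i \<subseteq> ball (p i) r"
proof
  fix y assume y: "y \<in> voronoi_cell p n i"
  show "y \<in> ball (p i) r"
  proof (rule ccontr)
    assume "y \<notin> ball (p i) r"
    define w where "w = y - p i"
    define v where "v = w /\<^sub>R norm w"
    have w: "r \<le> norm w" using \<open>y \<notin> ball (p i) r\<close> by (simp add: w_def dist_norm norm_minus_commute)
    then have "w \<noteq> 0" using r by auto
    then have "norm v = 1" "w = norm w *\<^sub>R v" by (auto simp: v_def)
    then obtain u where u: "u \<in> D" "norm (u - v) < 1 / 4"
      using D by (force simp: dist_norm)
    obtain j where j: "j \<in> {1..n}" "norm (p i + r *\<^sub>R u - p j) < r / 4"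
      using hit[OF u(1)] by (auto simp: dist_norm)
    have "norm (r *\<^sub>R (u - v)) < r / 4" using u(2) r by simp
    moreover have "norm (w - r *\<^sub>R v) = norm w - r"
    proof -
      have "w - r *\<^sub>R v = (norm w - r) *\<^sub>R v" using \<open>w = norm w *\<^sub>R v\<close> by (metis scaleR_left_diff_distrib)
      then show ?thesis using w \<open>norm v = 1\<close> by simp
    qed
    moreover have eq: "y - p j = (w - r *\<^sub>R v) - r *\<^sub>R (u - v) + (p i + r *\<^sub>R u - p j)"
      by (simp add: w_def algebra_simps)
    have "norm (y - p j) \<le> norm (w - r *\<^sub>R v) + norm (r *\<^sub>R (u - v)) + norm (p i + r *\<^sub>R u - p j)"
      unfolding eq using norm_triangle_ineq[of "w - r *\<^sub>R v - r *\<^sub>R (u - v)" "p i + r *\<^sub>R u - p j"]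
        norm_triangle_ineq4[of "w - r *\<^sub>R v" "r *\<^sub>R (u - v)"] by linarith
    ultimately have "norm (y - p j) < norm w" using j(2) r by linarith
    moreover have "norm w \<le> norm (y - p j)"
      using y j(1) by (auto simp: voronoi_cell_def w_def)
    ultimately show False by simp
  qed
qed

lemma ediam_le_of_subset_ball:
  assumes "S \<subseteq> ball x r"
  shows "ediam S \<le> ennreal (2 * r)"
  unfolding ediam_def
proof (intro SUP_least ennreal_leI)
  fix y z assume "y \<in> S" "z \<in> S"
  then have "dist x y < r" "dist x z < r" using assms by auto
  then show "norm (y - z) \<le> 2 * r" using dist_triangle3[of y z x] by (simp add: dist_norm)
qed

section \<open>Probability of missing a ball\<close>

text \<open>The event in \<open>cond_prob_cell\<close> need not be shown measurable: a nonmeasurable set has \<open>measure\<close> 0.\<close>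

lemma cond_prob_cell_le:
  fixes X :: "nat \<Rightarrow> 'b \<Rightarrow> 'a::euclidean_space"
  assumes M: "prob_space M"
    and ind: "prob_space.indep_vars M (\<lambda>_. borel) X {1..}"
    and dist: "\<And>i. i \<ge> 1 \<Longrightarrow> distr M borel (X i) = \<mu>"
    and D: "finite D" "sphere 0 1 \<subseteq> (\<Union>u\<in>D. ball u (1 / 4))"
    and r: "0 < r" and n: "2 \<le> n" and t: "real n powr (1 / DIM('a)) * (2 * r) < t"
  shows "cond_prob_cell M X n t x \<le> (\<Sum>u\<in>D. (1 - measure \<mu> (ball (x + r *\<^sub>R u) (r / 4))) ^ (n - 1))"
proof -
  interpret M: prob_space M by fact
  have Xm: "X i \<in> borel_measurable M" if "i \<ge> 1" for i
    using ind that by (auto simp: M.indep_vars_def)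
  define b where "b = (\<lambda>u. ball (x + r *\<^sub>R u) (r / 4))"
  \<comment> \<open>\<open>E u\<close> is the event that all random sites miss \<open>b u\<close>.
    Indices start at 2 because the first site is fixed at \<open>x\<close>, whence the exponent
    \<open>n - 1\<close>.\<close>
  define E where "E = (\<lambda>u. \<Inter>i\<in>{2..n}. X i -` (- b u) \<inter> space M)"
  have b: "- b u \<in> sets borel" for u by (auto simp: b_def intro: borel_closed)
  \<comment> \<open>\<open>2 <= n\<close> keeps the index set nonempty; an intersection over the
    empty set would be \<open>UNIV\<close>.\<close>
  have Em: "E u \<in> sets M" for u
    unfolding E_def using n by (intro sets.finite_INT measurable_sets[OF Xm b]) auto
  have probX: "M.prob (X i -` (- b u) \<inter> space M) = 1 - measure \<mu> (b u)" if "i \<ge> 1" for i u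
  proof -
    interpret \<mu>: prob_space \<mu>
      using dist[OF that] M.prob_space_distr[OF Xm[OF that]] by simp
    have sp: "space \<mu> = UNIV" "sets \<mu> = sets borel" using dist[OF that] by auto
    have "M.prob (X i -` (- b u) \<inter> space M) = measure \<mu> (- b u)"
      using dist[OF that] measure_distr[OF Xm[OF that] b] by simp
    also have "\<dots> = 1 - measure \<mu> (b u)"
      using \<mu>.prob_compl[of "b u"] sp by (simp add: Compl_eq_Diff_UNIV b_def)
    finally show ?thesis .
  qed
  have "M.prob (E u) = (1 - measure \<mu> (b u)) ^ (n - 1)" for u
  proof -
    have "M.prob (E u) = (\<Prod>i\<in>{2..n}. M.prob (X i -` (- b u) \<inter> space M))"
      unfolding E_def by (rule M.indep_varsD[OF ind]) (use n b in auto)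
    also have "\<dots> = (\<Prod>i\<in>{2..n}. 1 - measure \<mu> (b u))"
      by (rule prod.cong) (auto simp: probX)
    finally show ?thesis by simp
  qed
  then have sum: "M.prob (\<Union>u\<in>D. E u) \<le> (\<Sum>u\<in>D. (1 - measure \<mu> (b u)) ^ (n - 1))"
    using M.finite_measure_subadditive_finite[OF D(1), of E] Em by auto
  \<comment> \<open>Outside the union every ball is hit, so the cell lies in a ball of radius
    \<open>r\<close> and its rescaled diameter is at most \<open>n powr (1 / d) * (2 * r)\<close>,
    less than \<open>t\<close>.\<close>
  have "{\<omega> \<in> space M. ennreal t \<le> ennreal (real n powr (1 / real DIM('a))) *
         ediam (voronoi_cell ((\<lambda>j. X j \<omega>)(1 := x)) n 1)} \<subseteq> (\<Union>u\<in>D. E u)"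
  proof
    fix \<omega> assume "\<omega> \<in> {\<omega> \<in> space M. ennreal t \<le> ennreal (real n powr (1 / real DIM('a))) *
         ediam (voronoi_cell ((\<lambda>j. X j \<omega>)(1 := x)) n 1)}"
    then have \<omega>: "\<omega> \<in> space M" and le: "ennreal t \<le> ennreal (real n powr (1 / real DIM('a))) *
         ediam (voronoi_cell ((\<lambda>j. X j \<omega>)(1 := x)) n 1)" by auto
    define p where "p = (\<lambda>j. X j \<omega>)(1 := x)"
    show "\<omega> \<in> (\<Union>u\<in>D. E u)"
    proof (rule ccontr)
      assume "\<omega> \<notin> (\<Union>u\<in>D. E u)"
      then have "\<omega> \<notin> E u" if "u \<in> D" for u
        using that by blast
      then have hit: "\<exists>j\<in>{2..n}. X j \<omega> \<in> b u" if "u \<in> D" for u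
        using that \<omega> unfolding E_def by blast
      have "\<exists>j\<in>{1..n}. p j \<in> ball (p 1 + r *\<^sub>R u) (r / 4)" if u: "u \<in> D" for u
      proof -
        obtain j where "j \<in> {2..n}" "X j \<omega> \<in> b u" using hit[OF u] by blast
        then show ?thesis by (intro bexI[of _ j]) (auto simp: p_def b_def)
      qed
      then have "voronoi_cell p n 1 \<subseteq> ball (p 1) r"
        by (rule voronoi_cell_subset_ball[OF D(2) r])
      then have "ediam (voronoi_cell p n 1) \<le> ennreal (2 * r)"
        by (rule ediam_le_of_subset_ball)
      then have "ennreal t \<le> ennreal (real n powr (1 / real DIM('a))) * ennreal (2 * r)"
        using le unfolding p_def by (meson mult_left_mono order_trans zero_le)
      also have "\<dots> = ennreal (real n powr (1 / real DIM('a)) * (2 * r))"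
        using r by (simp add: ennreal_mult)
      finally have "t \<le> real n powr (1 / real DIM('a)) * (2 * r)"
        using r by (simp add: ennreal_le_iff)
      then show False using t by simp
    qed
  qed
  then have "cond_prob_cell M X n t x \<le> M.prob (\<Union>u\<in>D. E u)"
    unfolding cond_prob_cell_def by (rule M.finite_measure_mono) (use D Em in auto)
  then show ?thesis using sum by (simp add: b_def)
qed

text \<open>Powers of \<open>1 - p <= 1 - a <= exp (- a)\<close>; \<open>p <= 1\<close> keeps the
  base nonnegative.\<close>

lemma power_one_minus_le_exp:
  assumes "p \<le> 1" "a \<le> (p::real)"
  shows "(1 - p) ^ k \<le> exp (- (a * real k))"
proof -
  have "(1 - p) ^ k \<le> exp (- a) ^ k"
    using assms exp_ge_add_one_self[of "- a"] by (intro power_mono) auto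
  also have "\<dots> = exp (- (a * real k))" by (simp add: exp_of_nat_mult[symmetric] mult.commute)
  finally show ?thesis .
qed

section \<open>Passage to the limit in n, then in t\<close>

theorem theorem4:
  fixes \<mu> :: "'a::euclidean_space measure"
    and f :: "'a \<Rightarrow> real"
    and M :: "'b measure"
    and X :: "nat \<Rightarrow> 'b \<Rightarrow> 'a"
  assumes "prob_space \<mu>"
    and "f \<in> borel_measurable borel"
    and "\<And>x. 0 \<le> f x"
    and "\<mu> = density lborel (\<lambda>x. ennreal (f x))"
    and "prob_space M"
    and "prob_space.indep_vars M (\<lambda>_. borel) X {1..}"
    and "\<And>i. i \<ge> 1 \<Longrightarrow> distr M borel (X i) = \<mu>"
  shows "AE x in \<mu>.
    ((\<lambda>t. limsup (\<lambda>n. ereal (cond_prob_cell M X n t x))) \<longlongrightarrow> 0) at_top"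
proof -
  interpret \<mu>: prob_space \<mu> by fact
  let ?d = "DIM('a)"
  obtain D :: "'a set" where D: "finite D" "D \<subseteq> sphere 0 1" "sphere 0 1 \<subseteq> (\<Union>u\<in>D. ball u (1 / 4))"
    by (rule compactE_image[of "sphere (0::'a) 1" "sphere 0 1" "\<lambda>u. ball u (1 / 4)"]) auto
  have "AE x in \<mu>. \<forall>u\<in>D. \<exists>c>0. \<forall>\<^sub>F r in at_right 0.
    c * r ^ ?d \<le> measure \<mu> (ball (x + r *\<^sub>R u) (r / 4))"
    by (intro AE_finite_allI D(1) AE_density_off_centre_ball_lower_bound[OF assms(1-4)]) (use D in auto)
  then show ?thesis
  proof eventually_elim
    fix x assume pos: "\<forall>u\<in>D. \<exists>c>0. \<forall>\<^sub>F r in at_right 0.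
      c * r ^ ?d \<le> measure \<mu> (ball (x + r *\<^sub>R u) (r / 4))"
    obtain c where c: "\<And>u. u \<in> D \<Longrightarrow> 0 < c u"
      and ev: "\<And>u. u \<in> D \<Longrightarrow> \<forall>\<^sub>F r in at_right 0. c u * r ^ ?d \<le> measure \<mu> (ball (x + r *\<^sub>R u) (r / 4))"
      using bchoice[OF pos] by blast
    define g where "g = (\<lambda>t. \<Sum>u\<in>D. exp (- (c u * (t / 3) ^ ?d / 2)))"
    have evD: "\<forall>\<^sub>F r in at_right 0. \<forall>u\<in>D. c u * r ^ ?d \<le> measure \<mu> (ball (x + r *\<^sub>R u) (r / 4))"
      using D(1) ev by (simp add: eventually_ball_finite_distrib)
    have upper: "limsup (\<lambda>n. ereal (cond_prob_cell M X n t x)) \<le> ereal (g t)" if t: "0 < t" for t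
    proof (rule Limsup_bounded)
      \<comment> \<open>The divisor 3 gives a rescaled diameter of at most \<open>2 * t / 3\<close>,
        strictly below \<open>t\<close>. As \<open>r n\<close> tends to 0 from the right, the mass
        bounds at \<open>x\<close> apply for large \<open>n\<close>.\<close>
      define r where "r = (\<lambda>n. t / 3 / real n powr (1 / ?d))"
      have "filterlim r (at_right 0) sequentially"
        unfolding r_def using t by real_asymp
      then have "\<forall>\<^sub>F n in sequentially. \<forall>u\<in>D. c u * r n ^ ?d \<le> measure \<mu> (ball (x + r n *\<^sub>R u) (r n / 4))"
        using evD by (auto simp: filterlim_iff)
      then show "\<forall>\<^sub>F n in sequentially. ereal (cond_prob_cell M X n t x) \<le> ereal (g t)"
        using eventually_ge_at_top[of 2]
      proof eventually_elim
        fix n :: nat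
        assume lower: "\<forall>u\<in>D. c u * r n ^ ?d \<le> measure \<mu> (ball (x + r n *\<^sub>R u) (r n / 4))" and n: "2 \<le> n"
        have rn: "0 < r n" "real n powr (1 / ?d) * (2 * r n) < t"
          using n t by (auto simp: r_def)
        \<comment> \<open>The scaling by \<open>n powr (1 / d)\<close> makes this product
          independent of \<open>n\<close>: the expected number of sites in each ball stays bounded
          below.\<close>
        have rd: "r n ^ ?d * real n = (t / 3) ^ ?d"
          using n by (simp add: r_def power_divide powr_power)
        have "(1 - measure \<mu> (ball (x + r n *\<^sub>R u) (r n / 4))) ^ (n - 1) \<le> exp (- (c u * (t / 3) ^ ?d / 2))"
          if u: "u \<in> D" for u
        proof -
          have "(1 - measure \<mu> (ball (x + r n *\<^sub>R u) (r n / 4))) ^ (n - 1) \<le> exp (- (c u * r n ^ ?d * real (n - 1)))"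
            using lower u by (intro power_one_minus_le_exp) auto
          \<comment> \<open>\<open>n >= 2\<close> gives \<open>n / 2 <= n - 1\<close>; this is the
            factor \<open>1 / 2\<close> in the exponents of \<open>g\<close>.\<close>
          also have "c u * r n ^ ?d * (real n / 2) \<le> c u * r n ^ ?d * real (n - 1)"
            using c[OF u] rn n by (intro mult_left_mono) auto
          then have "exp (- (c u * r n ^ ?d * real (n - 1))) \<le> exp (- (c u * (r n ^ ?d * real n) / 2))"
            by simp
          finally show ?thesis by (simp add: rd)
        qed
        then have "(\<Sum>u\<in>D. (1 - measure \<mu> (ball (x + r n *\<^sub>R u) (r n / 4))) ^ (n - 1)) \<le> g t"
          unfolding g_def by (rule sum_mono)
        then show "ereal (cond_prob_cell M X n t x) \<le> ereal (g t)"
          using cond_prob_cell_le[OF assms(5-7) D(1,3) rn(1) n rn(2), of x] by simp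
      qed
    qed
    have lower: "0 \<le> limsup (\<lambda>n. ereal (cond_prob_cell M X n t x))" for t
      by (rule le_Limsup) (auto simp: cond_prob_cell_def)
    have "(g \<longlongrightarrow> (\<Sum>u\<in>D. 0)) at_top"
      unfolding g_def
    proof (rule tendsto_sum)
      fix u assume "u \<in> D"
      then have "0 < c u" by (rule c)
      \<comment> \<open>A positive dimension makes \<open>(t / 3) ^ d\<close> unbounded, so each
        exponential decays.\<close>
      moreover have "0 < ?d" by simp
      ultimately show "((\<lambda>t. exp (- (c u * (t / 3) ^ ?d / 2))) \<longlongrightarrow> 0) at_top"
        by real_asymp
    qed
    then have "((\<lambda>t. ereal (g t)) \<longlongrightarrow> 0) at_top"
      by (simp add: zero_ereal_def)
    then show "((\<lambda>t. limsup (\<lambda>n. ereal (cond_prob_cell M X n t x))) \<longlongrightarrow> 0) at_top"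
    proof (rule tendsto_sandwich[rotated 3])
      show "\<forall>\<^sub>F t in at_top. limsup (\<lambda>n. ereal (cond_prob_cell M X n t x)) \<le> ereal (g t)"
        using eventually_gt_at_top[of 0] by eventually_elim (rule upper)
    qed (use lower in auto)
  qed
qed

end
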